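(* For all $n \geq 6$, \[\text{ex}_o(n,H_1)=\left\lfloor \frac{n}{2} \right\rfloor (n-2).\]
   Context: A $(2\to 1)$-graph (directed hypergraph) is a pair $H=(V,E)$ with $V$ a finite set and $E$ a set of pointed $3$-subsets of $V$: an edge, written $ab\to c$ (same as $ba\to c$), consists of three distinct vertices with head $c$ and tail set $\{a,b\}$. $H$ is oriented if every $3$-subset of $V$ carries at most one edge. $H$ is $F$-free if there is no injective map $\phi:V(F)\to V(H)$ such that $ab\to c\in E(F)$ implies $\phi(a)\phi(b)\to\phi(c)\in E(H)$. $\text{ex}_o(n,F)$ is the maximum number of edges of an $F$-free oriented $(2\to1)$-graph on $n$ vertices. $H_1$ is the $(2\to1)$-graph with vertex set $\{a,b,c,d,x\}$ (five distinct vertices) and edges $ax\to b$, $cx\to d$. *)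

theory Defs
  imports Main
begin

text \<open>
  The edge \<open>ab \<rightarrow> c\<close> is encoded as \<open>({a, b}, c)\<close>: the unordered tail set together with the head.
\<close>

type_synonym 'a edge = "'a set \<times> 'a"

record 'a dhgraph =
  verts :: "'a set"
  edges :: "'a edge set"

definition support :: "'a edge \<Rightarrow> 'a set" where
  "support e = insert (snd e) (fst e)"

definition two_one_graph :: "'a dhgraph \<Rightarrow> bool" where
  "two_one_graph H \<longleftrightarrow> finite (verts H) \<and>
     (\<forall>(T, h) \<in> edges H. T \<subseteq> verts H \<and> card T = 2 \<and> h \<in> verts H \<and> h \<notin> T)"

definition oriented :: "'a dhgraph \<Rightarrow> bool" where
  "oriented H \<longleftrightarrow>
     (\<forall>S. S \<subseteq> verts H \<and> card S = 3 \<longrightarrow> card {e \<in> edges H. support e = S} \<le> 1)"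

definition embedding :: "('a \<Rightarrow> 'b) \<Rightarrow> 'a dhgraph \<Rightarrow> 'b dhgraph \<Rightarrow> bool" where
  "embedding \<phi> F H \<longleftrightarrow> \<phi> ` verts F \<subseteq> verts H \<and> inj_on \<phi> (verts F) \<and>
     (\<forall>(T, h) \<in> edges F. (\<phi> ` T, \<phi> h) \<in> edges H)"

definition free_of :: "'a dhgraph \<Rightarrow> 'b dhgraph \<Rightarrow> bool" where
  "free_of F H \<longleftrightarrow> (\<nexists>\<phi>. embedding \<phi> F H)"

text \<open>
  Every graph on \<open>n\<close> vertices is isomorphic to one whose vertices are natural numbers, so
  vertices of type \<open>nat\<close> suffice.  The set below is finite, its elements being
  at most \<open>n * (n choose 2)\<close>; it is nonempty, so that \<open>Max\<close> is meaningful, whenever \<open>F\<close> has an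
  edge, since then the edgeless graph is \<open>F\<close>-free.
\<close>

definition ex_o :: "nat \<Rightarrow> 'a dhgraph \<Rightarrow> nat" where
  "ex_o n F = Max {card (edges H) | H :: nat dhgraph.
     two_one_graph H \<and> oriented H \<and> card (verts H) = n \<and> free_of F H}"

datatype H1_vertex = Va | Vb | Vc | Vd | Vx

definition H1 :: "H1_vertex dhgraph" where
  "H1 = \<lparr>verts = {Va, Vb, Vc, Vd, Vx}, edges = {({Va, Vx}, Vb), ({Vc, Vx}, Vd)}\<rparr>"

end

theory Submission
  imports Defs
begin

text \<open>
  For a vertex \<open>x\<close>, the pairs left over when \<open>x\<close> is removed from the edges having \<open>x\<close> in the tail
  pairwise intersect, so they form a star, with centre \<open>f x\<close> and at most \<open>n - 2\<close> members, or a
  triangle, with only three members. Summing over \<open>x\<close> counts every edge twice, which settles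
  even \<open>n\<close> as well as odd \<open>n\<close> with at least two triangles.

  For odd \<open>n\<close> with at most one triangle, look at the pairs \<open>{x, f x}\<close> with \<open>f (f x) = x\<close>. If there
  are \<open>m\<close> of them, at most \<open>m (n - 2)\<close> edges contain one. All other edges have both tail
  vertices outside these pairs; apart from the three triangle edges they are determined by
  their tail, which gives the bound when \<open>m > 0\<close>. When \<open>m = 0\<close>, sufficiently many pairs are
  not the tail of an edge: every vertex outside a short \<open>f\<close>-path misses some vertex on it.

  For the lower bound, partition the vertices into pairs (up to one) and join each pair to all
  possible heads.
\<close>

section \<open>Families of pairs\<close>

text \<open>If neither end of a member \<open>{p, q}\<close> is common to all, one member avoids
  \<open>p\<close> and so contains \<open>q\<close>, another avoids \<open>q\<close> and so contains
  \<open>p\<close>, and these two meet in some \<open>r\<close>. A pair meeting all three sides of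
  the triangle \<open>p q r\<close> is itself a side.\<close>

lemma intersecting_pairs_cases:
  assumes two: "\<And>A. A \<in> F \<Longrightarrow> card A = 2"
    and meet: "\<And>A B. A \<in> F \<Longrightarrow> B \<in> F \<Longrightarrow> A \<inter> B \<noteq> {}"
    and "F \<noteq> {}"
  obtains (star) c where "c \<in> \<Union>F" "\<And>A. A \<in> F \<Longrightarrow> c \<in> A"
    | (triangle) p q r where "distinct [p, q, r]" "F = {{p, q}, {q, r}, {p, r}}"
proof (cases "\<exists>c \<in> \<Union>F. \<forall>A \<in> F. c \<in> A")
  case True
  then show ?thesis using star by blast
next
  case False
  obtain A where A: "A \<in> F" using \<open>F \<noteq> {}\<close> by blast
  obtain p q where pq: "A = {p, q}" "p \<noteq> q" using two[OF A] by (auto simp: card_2_iff)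
  obtain B where B: "B \<in> F" "p \<notin> B" using False A pq by blast
  obtain C where C: "C \<in> F" "q \<notin> C" using False A pq by blast
  have "q \<in> B" using meet[OF A B(1)] B pq by auto
  then obtain r where r: "B = {q, r}" "r \<noteq> q"
    using two[OF B(1)] by (auto simp: card_2_iff insert_commute)
  have "p \<in> C" using meet[OF A C(1)] C pq by auto
  moreover have "r \<in> C" using meet[OF B(1) C(1)] C r by auto
  moreover have "p \<noteq> r" using B r by auto
  ultimately have Cpr: "C = {p, r}" using two[OF C(1)] by (auto simp: card_2_iff)
  have "D \<in> {{p, q}, {q, r}, {p, r}}" if D: "D \<in> F" for D
  proof -
    obtain x y where xy: "D = {x, y}" "x \<noteq> y" using two[OF D] by (auto simp: card_2_iff)
    have "x \<in> A \<or> y \<in> A" "x \<in> B \<or> y \<in> B" "x \<in> C \<or> y \<in> C"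
      using meet[OF D A] meet[OF D B(1)] meet[OF D C(1)] xy by auto
    then show ?thesis
      using pq(2) r(2) \<open>p \<noteq> r\<close> xy(2) unfolding xy(1) pq(1) r(1) Cpr by (auto simp: doubleton_eq_iff)
  qed
  then have "F = {{p, q}, {q, r}, {p, r}}" using A B C pq r Cpr by auto
  then show ?thesis using triangle[of p q r] pq r \<open>p \<noteq> r\<close> by auto
qed

text \<open>Choosing a partner \<open>q\<close> for each \<open>w\<close> gives an injective map
  from \<open>w\<close> to \<open>{w, q}\<close>, because \<open>X\<close> and \<open>Q\<close> are
  disjoint, and its values avoid \<open>N'\<close>. Below, \<open>N\<close> is
  \<open>nontails\<close>, \<open>Q\<close> consists of a few vertices on an \<open>f\<close>-path,
  and \<open>N'\<close> of pairs found separately.\<close>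

lemma card_ge_pairs:
  assumes "finite N" "N' \<subseteq> N" "X \<inter> Q = {}"
    and missing: "\<And>w. w \<in> X \<Longrightarrow> \<exists>q \<in> Q. {w, q} \<in> N \<and> {w, q} \<notin> N'"
  shows "card X + card N' \<le> card N"
proof -
  from missing obtain g where g: "\<And>w. w \<in> X \<Longrightarrow> g w \<in> Q \<and> {w, g w} \<in> N \<and> {w, g w} \<notin> N'"
    by metis
  let ?h = "\<lambda>w. {w, g w}"
  have "inj_on ?h X"
    using g \<open>X \<inter> Q = {}\<close> by (fastforce simp: inj_on_def doubleton_eq_iff)
  then have "card X = card (?h ` X)" by (simp add: card_image)
  moreover have "?h ` X \<subseteq> N" "?h ` X \<inter> N' = {}" using g by auto
  ultimately have "card X + card N' = card (?h ` X \<union> N')"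
    using \<open>finite N\<close> \<open>N' \<subseteq> N\<close> by (simp add: card_Un_disjoint finite_subset)
  also have "\<dots> \<le> card N"
    using \<open>?h ` X \<subseteq> N\<close> \<open>N' \<subseteq> N\<close> \<open>finite N\<close> by (intro card_mono) auto
  finally show ?thesis .
qed

section \<open>Out-edges: stars and triangles\<close>

text \<open>\<open>inj_support\<close> expresses orientedness, so edges can be counted through their
  supports. \<open>meet\<close> expresses freeness: two edges with \<open>x\<close> in both tails
  and nothing else in common form a copy of \<open>H1\<close>.\<close>

locale h1_free =
  fixes V :: "'a set" and E :: "'a edge set"
  assumes finite_verts: "finite V"
    and edge: "(T, h) \<in> E \<Longrightarrow> T \<subseteq> V \<and> card T = 2 \<and> h \<in> V \<and> h \<notin> T"
    and inj_support: "inj_on support E"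
    and meet: "e \<in> E \<Longrightarrow> e' \<in> E \<Longrightarrow> x \<in> fst e \<Longrightarrow> x \<in> fst e' \<Longrightarrow>
      \<exists>c. c \<noteq> x \<and> c \<in> support e \<and> c \<in> support e'"
begin

definition out_edges :: "'a \<Rightarrow> 'a edge set" where
  "out_edges x = {e \<in> E. x \<in> fst e}"

text \<open>The centre may be the other tail vertex in some edges and the head in others. When
  \<open>out_edges x\<close> is empty, every other vertex of \<open>V\<close> is a centre, so
  \<open>x\<close> counts as a star.\<close>

definition centre_of :: "'a \<Rightarrow> 'a \<Rightarrow> bool" where
  "centre_of x c \<longleftrightarrow> c \<in> V \<and> c \<noteq> x \<and> (\<forall>e \<in> out_edges x. c \<in> support e)"

lemma finite_edges: "finite E"
proof (rule finite_subset)
  show "E \<subseteq> Pow V \<times> V" using edge by auto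
qed (simp add: finite_verts)

lemma edgeE:
  assumes "e \<in> E" "x \<in> fst e"
  obtains y h where "e = ({x, y}, h)" "distinct [x, y, h]" "x \<in> V" "y \<in> V" "h \<in> V"
    "support e = {x, y, h}"
proof -
  obtain T h where e: "e = (T, h)" by (cases e)
  then have T: "T \<subseteq> V" "card T = 2" "h \<in> V" "h \<notin> T" "x \<in> T" using edge assms by auto
  then obtain y where "T = {x, y}" "x \<noteq> y" by (auto simp: card_2_iff insert_commute)
  then show ?thesis using that e T by (auto simp: support_def)
qed

lemma out_edgesE:
  assumes "e \<in> out_edges x"
  obtains y h where "e = ({x, y}, h)" "distinct [x, y, h]" "x \<in> V" "y \<in> V" "h \<in> V"
    "support e = {x, y, h}"
  using edgeE[of e x] assms unfolding out_edges_def mem_Collect_eq by metis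

lemma finite_out_edges [simp]: "finite (out_edges x)"
  using finite_edges by (simp add: out_edges_def)

lemma sum_card_out_edges: "(\<Sum>x\<in>V. card (out_edges x)) = 2 * card E"
proof -
  have "(\<Sum>x\<in>V. card (out_edges x)) = (\<Sum>x\<in>V. \<Sum>e\<in>E. if x \<in> fst e then 1 else 0)"
    unfolding out_edges_def using finite_edges by (simp add: sum.If_cases Int_def)
  also have "\<dots> = (\<Sum>e\<in>E. \<Sum>x\<in>V. if x \<in> fst e then 1 else 0)" by (rule sum.swap)
  also have "\<dots> = (\<Sum>e\<in>E. 2)"
  proof (rule sum.cong)
    fix e assume "e \<in> E"
    then have "fst e \<subseteq> V" "card (fst e) = 2" using edge[of "fst e" "snd e"] by auto
    then show "(\<Sum>x\<in>V. if x \<in> fst e then 1 else 0) = (2::nat)"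
      using finite_verts by (simp add: sum.If_cases Int_absorb1)
  qed simp
  finally show ?thesis by simp
qed

lemma support_eqD: "e \<in> E \<Longrightarrow> e' \<in> E \<Longrightarrow> support e = support e' \<Longrightarrow> e = e'"
  using inj_support by (auto dest: inj_onD)

lemma card_supersets:
  assumes "A \<subseteq> V"
  shows "card ((\<lambda>y. insert y A) ` (V - A)) \<le> card V - card A"
proof -
  have "card ((\<lambda>y. insert y A) ` (V - A)) \<le> card (V - A)"
    using finite_verts by (intro card_image_le) auto
  then show ?thesis using assms finite_verts by (simp add: card_Diff_subset finite_subset)
qed

text \<open>The support of such an edge is \<open>{x, c}\<close> plus one of the remaining
  \<open>card V - 2\<close> vertices, and it determines the edge.\<close>

lemma card_out_edges_star:
  assumes "centre_of x c" "x \<in> V"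
  shows "card (out_edges x) \<le> card V - 2"
proof -
  have "support ` out_edges x \<subseteq> (\<lambda>y. insert y {x, c}) ` (V - {x, c})"
  proof
    fix A assume "A \<in> support ` out_edges x"
    then obtain e where e: "e \<in> out_edges x" "A = support e" by blast
    from e(1) obtain y h where yh: "e = ({x, y}, h)" "distinct [x, y, h]" "x \<in> V" "y \<in> V" "h \<in> V"
        "support e = {x, y, h}"
      by (rule out_edgesE)
    moreover have "c \<in> support e" "c \<noteq> x" using assms(1) e by (auto simp: centre_of_def)
    ultimately consider "c = y" | "c = h" by auto
    then show "A \<in> (\<lambda>y. insert y {x, c}) ` (V - {x, c})"
    proof cases
      case 1
      then show ?thesis using e yh by (intro image_eqI[of _ _ h]) auto
    next
      case 2
      then show ?thesis using e yh by (intro image_eqI[of _ _ y]) auto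
    qed
  qed
  then have "card (support ` out_edges x) \<le> card ((\<lambda>y. insert y {x, c}) ` (V - {x, c}))"
    using finite_verts by (intro card_mono) auto
  also have "\<dots> \<le> card V - 2"
    using card_supersets[of "{x, c}"] assms by (auto simp: centre_of_def)
  finally show ?thesis
    using inj_support by (simp add: card_image out_edges_def inj_on_subset)
qed

text \<open>Deleting \<open>x\<close> from the supports leaves pairwise intersecting pairs, by
  \<open>meet\<close>. A common element of them would be a centre, so they form a triangle.\<close>

lemma no_centre_triangle:
  assumes "\<nexists>c. centre_of x c" "x \<in> V" "card V \<ge> 2"
  obtains p q r where "distinct [x, p, q, r]" "{p, q, r} \<subseteq> V"
    "support ` out_edges x = {{x, p, q}, {x, q, r}, {x, p, r}}"
proof -
  define F where "F = (\<lambda>e. support e - {x}) ` out_edges x"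
  have F: "card A = 2 \<and> A \<subseteq> V - {x} \<and> insert x A \<in> support ` out_edges x" if "A \<in> F" for A
  proof -
    obtain e where e: "e \<in> out_edges x" "A = support e - {x}"
      using \<open>A \<in> F\<close> unfolding F_def by blast
    from e(1) obtain y h where yh: "e = ({x, y}, h)" "distinct [x, y, h]" "x \<in> V" "y \<in> V" "h \<in> V"
        "support e = {x, y, h}"
      by (rule out_edgesE)
    then have "A = {y, h}" "insert x A = support e" using e by auto
    then show ?thesis using yh e by auto
  qed
  have "A \<inter> B \<noteq> {}" if AB: "A \<in> F" "B \<in> F" for A B
  proof -
    obtain e e' where e: "e \<in> E" "x \<in> fst e" "A = support e - {x}"
      and e': "e' \<in> E" "x \<in> fst e'" "B = support e' - {x}"
      using AB unfolding F_def out_edges_def by blast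
    show ?thesis using meet[OF e(1) e'(1) e(2) e'(2)] e e' by blast
  qed
  moreover have "F \<noteq> {}"
  proof
    assume "F = {}"
    then have "out_edges x = {}" by (auto simp: F_def)
    \<comment> \<open>Without out-edges any second vertex is a centre, and
      \<open>card V \<ge> 2\<close> provides one.\<close>
    moreover have "\<not> card V \<le> Suc 0" using \<open>card V \<ge> 2\<close> by simp
    then obtain c where "c \<in> V" "c \<noteq> x"
      unfolding card_le_Suc0_iff_eq[OF finite_verts] by metis
    ultimately have "centre_of x c" by (simp add: centre_of_def)
    then show False using assms(1) by blast
  qed
  moreover have "card A = 2" if "A \<in> F" for A using F that by simp
  ultimately consider
      (star) c where "c \<in> \<Union>F" "\<And>A. A \<in> F \<Longrightarrow> c \<in> A"
    | (triangle) p q r where "distinct [p, q, r]" "F = {{p, q}, {q, r}, {p, r}}"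
    using intersecting_pairs_cases[of F] by metis
  then show thesis
  proof cases
    case (star c)
    have "centre_of x c"
      unfolding centre_of_def
    proof (intro conjI ballI)
      show "c \<in> V" "c \<noteq> x" using star(1) F by auto
      fix e assume "e \<in> out_edges x"
      then show "c \<in> support e" using star(2)[of "support e - {x}"] by (auto simp: F_def)
    qed
    then show ?thesis using assms(1) by blast
  next
    case (triangle p q r)
    have "support ` out_edges x = insert x ` F"
    proof -
      have "insert x (support e - {x}) = support e" if "e \<in> out_edges x" for e
        using that by (auto simp: out_edges_def support_def)
      then show ?thesis by (simp add: F_def image_image)
    qed
    also have "\<dots> = {{x, p, q}, {x, q, r}, {x, p, r}}" by (simp add: triangle)
    finally have "support ` out_edges x = {{x, p, q}, {x, q, r}, {x, p, r}}" .
    moreover have "{p, q} \<subseteq> V - {x}" "{q, r} \<subseteq> V - {x}" 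
      using F[of "{p, q}"] F[of "{q, r}"] triangle(2) by blast+
    ultimately show ?thesis using that[of p q r] triangle(1) by auto
  qed
qed

lemma card_out_edges_triangle:
  assumes "\<nexists>c. centre_of x c" "x \<in> V" "card V \<ge> 2"
  shows "card (out_edges x) \<le> 3"
proof -
  obtain p q r where "distinct [x, p, q, r]" "{p, q, r} \<subseteq> V"
      "support ` out_edges x = {{x, p, q}, {x, q, r}, {x, p, r}}"
    by (rule no_centre_triangle[OF assms])
  then have "card (support ` out_edges x) \<le> 3" by (simp add: card_insert_if)
  then show ?thesis
    using inj_support by (simp add: card_image out_edges_def inj_on_subset)
qed

end

section \<open>Star centres and edges determined by their tails\<close>

text \<open>\<open>S\<close> will be all of \<open>V\<close>, or \<open>V\<close> without its only
  triangle vertex, and \<open>f\<close> an arbitrary choice of centres on \<open>S\<close>.\<close>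

locale centred_h1_free = h1_free +
  fixes S :: "'a set" and f :: "'a \<Rightarrow> 'a"
  assumes S_subset: "S \<subseteq> V"
    and centre: "x \<in> S \<Longrightarrow> centre_of x (f x)"
begin

text \<open>If \<open>f x = y\<close> and \<open>f y = x\<close>, the centre conditions say nothing
  about the head of an edge with tail \<open>{x, y}\<close>, so these 2-cycles of \<open>f\<close>
  are counted separately.\<close>

definition mated :: "'a set" where
  "mated = {x \<in> S. f x \<in> S \<and> f (f x) = x}"

definition unmated_edges :: "'a edge set" where
  "unmated_edges = {e \<in> E. fst e \<inter> mated = {}}"

definition tails :: "'a set set" where
  "tails = fst ` {e \<in> unmated_edges. fst e \<subseteq> S}"

text \<open>An edge with one of these pairs as its tail would be in \<open>unmated_edges\<close>, so
  they are the pairs of unmated vertices of \<open>S\<close> that are the tail of no edge at all.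
  Lower bounds on their number are upper bounds on \<open>card tails\<close>.\<close>

definition nontails :: "'a set set" where
  "nontails = {A. A \<subseteq> S - mated \<and> card A = 2} - tails"

lemma finite_S: "finite S"
  using S_subset finite_verts finite_subset by blast

lemma f_in_V: "x \<in> S \<Longrightarrow> f x \<in> V" and f_neq: "x \<in> S \<Longrightarrow> f x \<noteq> x"
  using centre by (auto simp: centre_of_def)

lemma centre_in_support: "e \<in> E \<Longrightarrow> x \<in> fst e \<Longrightarrow> x \<in> S \<Longrightarrow> f x \<in> support e"
  using centre unfolding centre_of_def out_edges_def by blast

lemma arc_centre: "({x, y}, h) \<in> E \<Longrightarrow> x \<in> S \<Longrightarrow> f x = y \<or> f x = h"
  using centre_in_support[of "({x, y}, h)" x] f_neq[of x] by (auto simp: support_def)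

lemma edge_distinct: "({x, y}, h) \<in> E \<Longrightarrow> distinct [x, y, h]"
  using edge[of "{x, y}" h] by (auto simp: card_insert_if split: if_splits)

lemma mated_subset: "mated \<subseteq> S"
  by (auto simp: mated_def)

text \<open>On \<open>mated\<close> the map \<open>f\<close> is an involution without fixed points,
  so the pairs are disjoint.\<close>

lemma card_mated_pairs: "2 * card ((\<lambda>x. {x, f x}) ` mated) = card mated"
proof -
  let ?P = "(\<lambda>x. {x, f x}) ` mated"
  have "2 * card ?P = card (\<Union>?P)"
  proof (rule card_partition)
    have "finite mated" using finite_S mated_subset finite_subset by blast
    then show "finite ?P" "finite (\<Union>?P)" by auto
    fix A B assume AB: "A \<in> ?P" "B \<in> ?P"
    obtain x where "x \<in> S" "A = {x, f x}" using AB(1) mated_subset by blast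
    then show "card A = 2" using f_neq[of x] by auto
    obtain y where y: "y \<in> mated" "A = {y, f y}" using AB(1) by blast
    obtain z where z: "z \<in> mated" "B = {z, f z}" using AB(2) by blast
    have ff: "f (f y) = y" "f (f z) = z" using y z by (simp_all add: mated_def)
    assume "A \<noteq> B"
    then have "y \<noteq> z" "y \<noteq> f z" unfolding y(2) z(2) using ff by (metis, metis insert_commute)
    moreover from this have "f y \<noteq> z" "f y \<noteq> f z" using ff by metis+
    ultimately show "A \<inter> B = {}" unfolding y(2) z(2) by simp
  qed
  also have "\<Union>?P = mated"
  proof
    have "f x \<in> mated" if "x \<in> mated" for x using that by (simp add: mated_def)
    then show "\<Union>?P \<subseteq> mated" by blast
  qed blast
  finally show ?thesis .
qed

text \<open>An edge with a mated \<open>x\<close> in its tail also contains the centre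
  \<open>f x\<close>, so its support is one of the mated pairs plus a third vertex, for which there
  are \<open>card V - 2\<close> choices.\<close>

lemma card_mated_edges: "2 * card (E - unmated_edges) \<le> card mated * (card V - 2)"
proof -
  let ?P = "(\<lambda>x. {x, f x}) ` mated" and ?U = "\<lambda>A. (\<lambda>y. insert y A) ` (V - A)"
  have finP: "finite ?P" using finite_S mated_subset finite_subset by blast
  have "support ` (E - unmated_edges) \<subseteq> (\<Union>A\<in>?P. ?U A)"
  proof
    fix B assume "B \<in> support ` (E - unmated_edges)"
    then obtain e x where e: "e \<in> E" "B = support e" "x \<in> fst e" "x \<in> mated"
      by (auto simp: unmated_edges_def)
    then have x: "x \<in> S" using mated_subset by blast
    have fx: "f x \<in> support e" using centre_in_support e(1,3) x by blast
    obtain y h where yh: "e = ({x, y}, h)" "distinct [x, y, h]" "x \<in> V" "y \<in> V" "h \<in> V"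
        "support e = {x, y, h}"
      using e(1,3) by (rule edgeE)
    then have "f x = y \<or> f x = h" using fx f_neq[OF x] by auto
    then have "B \<in> ?U {x, f x}"
    proof
      assume "f x = y"
      then show ?thesis using yh e(2) by (intro image_eqI[of _ _ h]) auto
    next
      assume "f x = h"
      then show ?thesis using yh e(2) by (intro image_eqI[of _ _ y]) auto
    qed
    then show "B \<in> (\<Union>A\<in>?P. ?U A)" using e(4) by blast
  qed
  then have "card (support ` (E - unmated_edges)) \<le> card (\<Union>A\<in>?P. ?U A)"
    using finP finite_verts by (intro card_mono finite_UN_I) auto
  also have "\<dots> \<le> (\<Sum>A\<in>?P. card (?U A))" using finP by (rule card_UN_le)
  also have "\<dots> \<le> (\<Sum>A\<in>?P. card V - 2)"
  proof (rule sum_mono)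
    fix A assume "A \<in> ?P"
    then obtain x where "x \<in> mated" and A: "A = {x, f x}" by blast
    then have x: "x \<in> S" "f x \<in> S" by (simp_all add: mated_def)
    then have "A \<subseteq> V" using S_subset A by blast
    moreover have "card A = 2" using f_neq[OF x(1)] A by simp
    ultimately show "card (?U A) \<le> card V - 2" using card_supersets[of A] by simp
  qed
  finally have "card (support ` (E - unmated_edges)) \<le> card ?P * (card V - 2)" by simp
  moreover have "card (support ` (E - unmated_edges)) = card (E - unmated_edges)"
    using inj_support by (intro card_image) (auto intro: inj_on_subset)
  ultimately have "2 * card (E - unmated_edges) \<le> (2 * card ?P) * (card V - 2)" by simp
  then show ?thesis unfolding card_mated_pairs .
qed

text \<open>Each of \<open>f x\<close> and \<open>f y\<close> is the other tail vertex or the head,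
  and \<open>x\<close> would be mated if both were the other tail vertex. In every remaining case
  \<open>f\<close> and the tail fix the head.\<close>

lemma head_cases:
  assumes "({x, y}, h) \<in> E" "x \<in> S" "y \<in> S" "x \<notin> mated"
  shows "f x = y \<and> h = f y \<or> f y = x \<and> h = f x \<or> f x = h \<and> f y = h"
proof -
  have "f x = y \<or> f x = h" using arc_centre assms by blast
  moreover have "f y = x \<or> f y = h" using arc_centre[of y x h] assms by (simp add: insert_commute)
  moreover have "\<not> (f x = y \<and> f y = x)" using assms by (auto simp: mated_def)
  ultimately show ?thesis by auto
qed

lemma tailsE:
  assumes "{x, y} \<in> tails"
  obtains h where "({x, y}, h) \<in> E" "distinct [x, y, h]" "x \<in> S" "y \<in> S"
    "f x = y \<and> h = f y \<or> f y = x \<and> h = f x \<or> f x = h \<and> f y = h"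
proof -
  from assms obtain h where h: "({x, y}, h) \<in> E" "x \<in> S" "y \<in> S" "x \<notin> mated"
    unfolding tails_def unmated_edges_def by auto
  show ?thesis using that[OF h(1) edge_distinct[OF h(1)] h(2,3) head_cases[OF h]] .
qed

lemma nontailsI:
  assumes "x \<in> S - mated" "y \<in> S - mated" "x \<noteq> y" "{x, y} \<notin> tails"
  shows "{x, y} \<in> nontails"
  using assms by (simp add: nontails_def)

text \<open>Mostly used contrapositively, to recognise nontails from values of \<open>f\<close>
  alone.\<close>

lemma tails_adjacent: "{x, y} \<in> tails \<Longrightarrow> f x = y \<or> f y = x \<or> f x = f y"
  by (metis tailsE)

lemma tails_subset: "tails \<subseteq> {A. A \<subseteq> S - mated \<and> card A = 2}"
proof
  fix A assume "A \<in> tails"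
  then obtain h where "(A, h) \<in> E" "A \<inter> mated = {}" "A \<subseteq> S"
    by (auto simp: tails_def unmated_edges_def)
  then show "A \<in> {A. A \<subseteq> S - mated \<and> card A = 2}" using edge[of A h] by blast
qed

lemma card_tails: "card {e \<in> unmated_edges. fst e \<subseteq> S} = card tails"
proof -
  have "inj_on fst {e \<in> unmated_edges. fst e \<subseteq> S}"
  proof (rule inj_onI)
    fix e e' assume *: "e \<in> {e \<in> unmated_edges. fst e \<subseteq> S}" "e' \<in> {e \<in> unmated_edges. fst e \<subseteq> S}"
      "fst e = fst e'"
    have "card (fst e) = 2" using edge[of "fst e" "snd e"] *(1) by (simp add: unmated_edges_def)
    then obtain x y where xy: "fst e = {x, y}" "x \<noteq> y" by (auto simp: card_2_iff)
    then have "e = ({x, y}, snd e)" "e' = ({x, y}, snd e')" using *(3) by (simp_all add: prod_eq_iff)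
    then have h: "({x, y}, snd e) \<in> E" "({x, y}, snd e') \<in> E" "x \<in> S" "y \<in> S" "x \<notin> mated"
      using *(1,2) xy(1) by (auto simp: unmated_edges_def)
    \<comment> \<open>Both edges fall under the same alternative of \<open>head_cases\<close>, since
      any mixture would put a head inside the tail.\<close>
    have "snd e = snd e'"
      using head_cases[OF h(1,3,4,5)] head_cases[OF h(2,3,4,5)]
        edge_distinct[OF h(1)] edge_distinct[OF h(2)]
      unfolding distinct_length_2_or_more by metis
    then show "e = e'" using *(3) by (simp add: prod_eq_iff)
  qed
  then show ?thesis by (simp add: card_image tails_def)
qed

lemma finite_nontails: "finite nontails"
  using finite_S by (intro finite_subset[of nontails "Pow S"]) (auto simp: nontails_def)

lemma card_tails_plus_nontails: "card tails + card nontails = card (S - mated) choose 2"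
proof -
  have fin: "finite {A. A \<subseteq> S - mated \<and> card A = 2}"
    by (rule finite_subset[of _ "Pow S"]) (use finite_S in auto)
  then have "card tails + card nontails = card {A. A \<subseteq> S - mated \<and> card A = 2}"
    unfolding nontails_def using tails_subset
    by (simp add: card_Diff_subset card_mono finite_subset[OF tails_subset])
  also have "\<dots> = card (S - mated) choose 2" using finite_S by (simp add: n_subsets)
  finally show ?thesis .
qed

section \<open>Lower bounds for the number of nontails\<close>

text \<open>Were two of the three pairs inside the cycle tails, both edges would have support
  \<open>{p, q, r}\<close>; hence two of the pairs are nontails. Each of the other
  \<open>card V - 3\<close> vertices contributes one more.\<close>

lemma nontails_cycle:
  assumes S: "S = V" and M: "mated = {}"
    and cycle: "p \<in> V" "q \<in> V" "r \<in> V" "f p = q" "f q = r" "f r = p"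
  shows "card V - 1 \<le> card nontails"
proof -
  have ne: "p \<noteq> q" "q \<noteq> r" "p \<noteq> r" using f_neq cycle S by metis+
  have supp: "support ({p, q}, r) = {p, q, r}" "support ({q, r}, p) = {p, q, r}"
      "support ({p, r}, q) = {p, q, r}"
    by (auto simp: support_def)
  have head: "({p, q}, r) \<in> E" if "{p, q} \<in> tails"
    using that by (rule tailsE) (use cycle ne in metis)
  have head': "({q, r}, p) \<in> E" if "{q, r} \<in> tails"
    using that by (rule tailsE) (use cycle ne in metis)
  have head'': "({p, r}, q) \<in> E" if "{p, r} \<in> tails"
    using that by (rule tailsE) (use cycle ne in metis)
  have "\<not> ({p, q} \<in> tails \<and> {q, r} \<in> tails)" "\<not> ({p, q} \<in> tails \<and> {p, r} \<in> tails)"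
      "\<not> ({q, r} \<in> tails \<and> {p, r} \<in> tails)"
    using support_eqD[of "({p, q}, r)" "({q, r}, p)"] support_eqD[of "({p, q}, r)" "({p, r}, q)"]
      support_eqD[of "({q, r}, p)" "({p, r}, q)"] head head' head'' supp ne by auto
  moreover have "{x, y} \<in> nontails" if "{x, y} \<notin> tails" "x \<noteq> y" "x \<in> V" "y \<in> V" for x y
    using that nontailsI S M by simp
  ultimately consider "{p, q} \<in> nontails" "{q, r} \<in> nontails"
    | "{p, q} \<in> nontails" "{p, r} \<in> nontails" | "{q, r} \<in> nontails" "{p, r} \<in> nontails"
    using ne cycle(1-3) by metis
  then obtain A B where AB: "A \<noteq> B" "A \<in> nontails" "B \<in> nontails" "A \<subseteq> {p, q, r}" "B \<subseteq> {p, q, r}"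
  proof cases
    case 1
    show ?thesis by (rule that[OF _ 1]) (use ne in \<open>auto simp: doubleton_eq_iff\<close>)
  next
    case 2
    show ?thesis by (rule that[OF _ 2]) (use ne in \<open>auto simp: doubleton_eq_iff\<close>)
  next
    case 3
    show ?thesis by (rule that[OF _ 3]) (use ne in \<open>auto simp: doubleton_eq_iff\<close>)
  qed
  have "card (V - {p, q, r}) + card {A, B} \<le> card nontails"
  proof (rule card_ge_pairs[where Q = "{p, q, r}"])
    fix w assume w: "w \<in> V - {p, q, r}"
    then have "f w \<in> V" "f w \<noteq> w" using f_in_V f_neq S by auto
    \<comment> \<open>As \<open>f p = q\<close>, the pair \<open>{w, p}\<close> can be a tail only
      if \<open>f w\<close> is \<open>p\<close> or \<open>q\<close>; likewise \<open>{w, q}\<close>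
      requires \<open>q\<close> or \<open>r\<close>, and \<open>{w, r}\<close> requires
      \<open>r\<close> or \<open>p\<close>. No value of \<open>f w\<close> satisfies all
      three.\<close>
    have "{w, p} \<notin> tails \<or> {w, q} \<notin> tails \<or> {w, r} \<notin> tails"
      using tails_adjacent[of w p] tails_adjacent[of w q] tails_adjacent[of w r] cycle(4-6) w ne
      by auto
    then have "\<exists>x\<in>{p, q, r}. {w, x} \<in> nontails"
      using nontailsI[of w] S M w cycle(1-3) by auto
    then show "\<exists>x\<in>{p, q, r}. {w, x} \<in> nontails \<and> {w, x} \<notin> {A, B}"
      using w AB by blast
  qed (use finite_nontails AB in auto)
  moreover have "card {A, B} = 2" using AB by simp
  moreover have "card (V - {p, q, r}) = card V - 3"
    using finite_verts cycle ne by (simp add: card_Diff_subset)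
  moreover have "card {p, q, r} \<le> card V" using finite_verts cycle by (intro card_mono) auto
  then have "3 \<le> card V" using ne by simp
  ultimately show ?thesis by linarith
qed

text \<open>As \<open>f (f x)\<close> is never \<open>x\<close>, the \<open>f\<close>-path
  \<open>p, q, r, s\<close> either runs into a 3-cycle or, otherwise, consists of four distinct
  vertices. Then three special nontails, besides one for each of the other \<open>card V - 4\<close>
  vertices, give the bound.\<close>

lemma nontails_without_mates:
  assumes S: "S = V" and M: "mated = {}" and "card V \<ge> 5"
  shows "card V - 1 \<le> card nontails"
proof -
  have fV: "f x \<in> V" and fx: "f x \<noteq> x" if "x \<in> V" for x
    using that f_in_V f_neq S by auto
  have ff: "f (f x) \<noteq> x" if "x \<in> V" for x
    using that fV S M unfolding mated_def by blast
  have nt: "{x, y} \<in> nontails" if "x \<noteq> y" "x \<in> V" "y \<in> V" "f x \<noteq> y" "f y \<noteq> x" "f x \<noteq> f y" for x y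
    using that nontailsI[of x y] tails_adjacent[of x y] S M by auto
  obtain p where p: "p \<in> V" using \<open>card V \<ge> 5\<close> by fastforce
  define q r s where "q = f p" and "r = f q" and "s = f r"
  note qrs = this[symmetric]
  have V: "p \<in> V" "q \<in> V" "r \<in> V" "s \<in> V" using fV p by (simp_all add: qrs[symmetric])
  have ne: "p \<noteq> q" "q \<noteq> r" "r \<noteq> s" "p \<noteq> r" "q \<noteq> s"
    using fx[OF V(1)] fx[OF V(2)] fx[OF V(3)] ff[OF V(1)] ff[OF V(2)] unfolding qrs by auto
  show ?thesis
  proof (cases "s = p \<or> f s = q")
    case True
    then show ?thesis
      using nontails_cycle[OF S M V(1-3)] nontails_cycle[OF S M V(2-4)] qrs by blast
  next
    case False
    have fs: "f s \<noteq> r" using ff[OF V(3)] qrs by simp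
    have d: "distinct [p, q, r, s]" using ne False by auto
    have card4: "card (V - {p, q, r, s}) = card V - 4"
      using finite_verts V d by (simp add: card_Diff_subset)
    have pr: "{p, r} \<in> nontails" using nt[OF ne(4) V(1,3)] False ne qrs by simp
    have qs: "{q, s} \<in> nontails" using nt[OF ne(5) V(2,4)] False ne qrs fs by simp
    show ?thesis
    proof (cases "f s = p")
      case True
      \<comment> \<open>On a 4-cycle, \<open>{w, p}\<close> requires \<open>f w\<close> in
        \<open>{p, q}\<close> while \<open>{w, r}\<close> requires it in \<open>{r, s}\<close>;
        similarly for \<open>q\<close> and \<open>s\<close>. So every outside vertex has two
        nontails into the cycle.\<close>
      have split: "({w, p} \<in> nontails \<or> {w, r} \<in> nontails) \<and> ({w, q} \<in> nontails \<or> {w, s} \<in> nontails)"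
        if w: "w \<in> V - {p, q, r, s}" for w
      proof -
        have "f w \<noteq> p \<and> f w \<noteq> q \<or> f w \<noteq> r \<and> f w \<noteq> s" "f w \<noteq> q \<and> f w \<noteq> r \<or> f w \<noteq> s \<and> f w \<noteq> p"
          using d by auto
        moreover have "w \<noteq> p" "w \<noteq> q" "w \<noteq> r" "w \<noteq> s" "w \<in> V" using w by auto
        ultimately show ?thesis
          using nt[of w p] nt[of w r] nt[of w q] nt[of w s] V unfolding qrs True by metis
      qed
      have "V - {p, q, r, s} \<noteq> {}"
      proof
        assume "V - {p, q, r, s} = {}"
        then have "card V - 4 = 0" using card4 by (metis card.empty)
        then show False using \<open>card V \<ge> 5\<close> by simp
      qed
      \<comment> \<open>The second nontail of a single outside vertex serves as the third special
        one.\<close>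
      then obtain w0 where w0: "w0 \<in> V - {p, q, r, s}" by blast
      then obtain y where y: "y \<in> {q, s}" "{w0, y} \<in> nontails" using split by blast
      have "card (V - {p, q, r, s}) + card {{p, r}, {q, s}, {w0, y}} \<le> card nontails"
      proof (rule card_ge_pairs[where Q = "{p, r}"])
        fix w assume w: "w \<in> V - {p, q, r, s}"
        then have "\<exists>x\<in>{p, r}. {w, x} \<in> nontails" using split by blast
        moreover have "{w, x} \<notin> {{p, r}, {q, s}, {w0, y}}" if "x \<in> {p, r}" for x
          using that w w0 y(1) d by (auto simp: doubleton_eq_iff)
        ultimately show "\<exists>x\<in>{p, r}. {w, x} \<in> nontails \<and> {w, x} \<notin> {{p, r}, {q, s}, {w0, y}}"
          by blast
      qed (use finite_nontails pr qs y in auto)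
      moreover have "card {{p, r}, {q, s}, {w0, y}} = 3"
        using w0 y(1) d by (auto simp: doubleton_eq_iff card_insert_if)
      ultimately show ?thesis using card4 by linarith
    next
      case fsp: False
      have ps: "{p, s} \<in> nontails" using nt[of p s] V d qrs False fsp by auto
      \<comment> \<open>\<open>Q\<close> leaves out \<open>s\<close> because \<open>f s\<close> may
        be \<open>w\<close>. The values of \<open>f w\<close> permitted by \<open>p\<close>,
        \<open>q\<close>, \<open>r\<close> are \<open>{p, q}\<close>, \<open>{q, r}\<close>,
        \<open>{r, s}\<close>, which have no common member.\<close>
      have "card (V - {p, q, r, s}) + card {{p, r}, {q, s}, {p, s}} \<le> card nontails"
      proof (rule card_ge_pairs[where Q = "{p, q, r}"])
        fix w assume w: "w \<in> V - {p, q, r, s}"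
        then have "w \<noteq> p" "w \<noteq> q" "w \<noteq> r" "w \<noteq> s" "w \<in> V" by auto
        moreover have "f w \<noteq> p \<and> f w \<noteq> q \<or> f w \<noteq> q \<and> f w \<noteq> r \<or> f w \<noteq> r \<and> f w \<noteq> s"
          using d by auto
        ultimately have "{w, p} \<in> nontails \<or> {w, q} \<in> nontails \<or> {w, r} \<in> nontails"
          using nt[of w p] nt[of w q] nt[of w r] V unfolding qrs by metis
        then have "\<exists>x\<in>{p, q, r}. {w, x} \<in> nontails" by blast
        moreover have "{w, x} \<notin> {{p, r}, {q, s}, {p, s}}" if "x \<in> {p, q, r}" for x
          using that w d by (auto simp: doubleton_eq_iff)
        ultimately show "\<exists>x\<in>{p, q, r}. {w, x} \<in> nontails \<and> {w, x} \<notin> {{p, r}, {q, s}, {p, s}}"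
          by blast
      qed (use finite_nontails pr qs ps in auto)
      moreover have "card {{p, r}, {q, s}, {p, s}} = 3"
        using d by (auto simp: doubleton_eq_iff card_insert_if)
      ultimately show ?thesis using card4 by linarith
    qed
  qed
qed

text \<open>These nontails compensate for the three edges at \<open>u\<close>. The heads of those
  edges turn the triangle \<open>p q r\<close> into a tournament, which is either transitive
  (\<open>fork\<close>) or cyclic.\<close>

lemma nontails_with_triangle:
  assumes S: "S = V - {u}" and M: "mated = {}" and "u \<in> V" "card V \<ge> 7"
    and pqr: "distinct [u, p, q, r]" "{p, q, r} \<subseteq> V"
    and triangle: "support ` out_edges u = {{u, p, q}, {u, q, r}, {u, p, r}}"
  shows "3 \<le> card nontails"
proof -
  define arc where "arc a b \<longleftrightarrow> ({u, a}, b) \<in> E" for a b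
  have arc_cases: "arc a b \<or> arc b a"
    if ab: "{u, a, b} \<in> support ` out_edges u" "distinct [u, a, b]" for a b
  proof -
    obtain e where e: "e \<in> out_edges u" "support e = {u, a, b}" using ab(1) by (metis imageE)
    from e(1) obtain y h where yh: "e = ({u, y}, h)" "distinct [u, y, h]" "support e = {u, y, h}"
      by (rule out_edgesE)
    then have "{u, y, h} = {u, a, b}" using e by simp
    then have "y = a \<and> h = b \<or> y = b \<and> h = a" using yh(2) ab(2) by (auto simp: set_eq_iff)
    then show ?thesis using e yh by (auto simp: arc_def out_edges_def)
  qed
  have arc_f: "f a = u \<or> f a = b" if "arc a b" "a \<in> S" for a b
    using that arc_centre[of a u b] by (simp add: arc_def insert_commute)
  \<comment> \<open>The head of the tail \<open>{a, b}\<close> cannot be \<open>u\<close>, since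
    \<open>({u, a}, b)\<close> already has that support. This rules out \<open>f a = u\<close>, so
    \<open>arc_f\<close> gives \<open>f a = b\<close>, and the head is \<open>f b\<close>.\<close>
  have arc_tail: "f a = b \<and> f b \<noteq> u \<and> f b \<noteq> a" if ab: "arc a b" "{a, b} \<in> tails" for a b
    using ab(2)
  proof (rule tailsE)
    fix h assume h: "({a, b}, h) \<in> E" "distinct [a, b, h]" "a \<in> S" "b \<in> S"
      "f a = b \<and> h = f b \<or> f b = a \<and> h = f a \<or> f a = h \<and> f b = h"
    have "h \<noteq> u"
    proof
      assume "h = u"
      then have "support ({a, b}, h) = support ({u, a}, b)" by (auto simp: support_def)
      then have "({a, b}, h) = ({u, a}, b)" using h(1) ab(1) support_eqD unfolding arc_def by blast
      then show False using h(2) by simp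
    qed
    moreover have "f a = u \<or> f a = b" using arc_f ab(1) h(3) by blast
    ultimately show ?thesis using h(2,5) by auto
  qed
  have nt: "{x, y} \<in> nontails" if "{x, y} \<notin> tails" "x \<noteq> y" "x \<in> S" "y \<in> S" for x y
    using that nontailsI M by simp
  have three: "3 \<le> card nontails"
    if "A \<in> nontails" "B \<in> nontails" "C \<in> nontails" "A \<noteq> B" "B \<noteq> C" "A \<noteq> C" for A B C
  proof -
    have "card {A, B, C} \<le> card nontails" using that finite_nontails by (intro card_mono) auto
    then show ?thesis using that by simp
  qed
  have cardS: "card S \<ge> 6" using S \<open>u \<in> V\<close> \<open>card V \<ge> 7\<close> finite_verts by simp
  \<comment> \<open>The two arcs leaving \<open>p\<close> force \<open>f p = u\<close>, so neither
    pair at \<open>p\<close> inside the triangle is a tail. The third nontail is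
    \<open>{q, r}\<close> or joins a further vertex to \<open>p\<close> or \<open>q\<close>.\<close>
  have fork: "3 \<le> card nontails"
    if arcs: "arc p q" "arc p r" "arc q r" and pqr: "distinct [u, p, q, r]" "{p, q, r} \<subseteq> S" for p q r
  proof -
    have fp: "f p = u" using arc_f[OF arcs(1)] arc_f[OF arcs(2)] pqr by auto
    have pq: "{p, q} \<in> nontails" using nt[of p q] arc_tail[OF arcs(1)] fp pqr by auto
    have pr: "{p, r} \<in> nontails" using nt[of p r] arc_tail[OF arcs(2)] fp pqr by auto
    show ?thesis
    proof (cases "{q, r} \<in> tails")
      case False
      then have "{q, r} \<in> nontails" using nt pqr by auto
      then show ?thesis using three[OF pq pr] pqr(1) by (simp add: doubleton_eq_iff)
    next
      case True
      then have fq: "f q = r" using arc_tail[OF arcs(3)] by blast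
      have "card {p, q, r} < card S" using cardS pqr(1) by simp
      then have "\<not> S \<subseteq> {p, q, r}" using card_mono[of "{p, q, r}" S] by (metis finite.emptyI finite.insertI leD)
      then obtain w where w: "w \<in> S" "w \<notin> {p, q, r}" by blast
      have "{w, p} \<notin> tails \<or> {w, q} \<notin> tails"
        using tails_adjacent[of w p] tails_adjacent[of w q] fp fq w pqr S by auto
      then obtain x where x: "x \<in> {p, q}" "{w, x} \<in> nontails" using nt w pqr by blast
      then show ?thesis using three[OF pq pr, of "{w, x}"] w pqr(1) by (auto simp: doubleton_eq_iff)
    qed
  qed
  have cyclic: "3 \<le> card nontails"
    if arcs: "arc p q" "arc q r" "arc r p" and pq: "{p, q} \<in> tails"
      and pqr: "distinct [u, p, q, r]" "{p, q, r} \<subseteq> S" for p q r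
  proof -
    have fp: "f p = q" and "f q \<noteq> u" using arc_tail[OF arcs(1) pq] by auto
    then have fq: "f q = r" using arc_f[OF arcs(2)] pqr by auto
    have fr: "f r = u \<or> f r = p" using arc_f[OF arcs(3)] pqr by auto
    \<comment> \<open>Otherwise the tails \<open>{r, p}\<close> and \<open>{p, q}\<close> would both
      belong to edges with support \<open>{p, q, r}\<close>.\<close>
    have "{r, p} \<notin> tails"
    proof
      assume rp: "{r, p} \<in> tails"
      then have "f r = p" using arc_tail arcs(3) by blast
      then have "({r, p}, q) \<in> E" using rp by (rule_tac tailsE[OF rp]) (use fp pqr in auto)
      moreover have "({p, q}, r) \<in> E" by (rule tailsE[OF pq]) (use fp fq pqr in auto)
      moreover have "support ({r, p}, q) = support ({p, q}, r)" by (auto simp: support_def)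
      ultimately have "({r, p}, q) = ({p, q}, r)" by (rule support_eqD)
      then show False using pqr by simp
    qed
    then have rp: "{r, p} \<in> nontails" using nt pqr by auto
    \<comment> \<open>Removing at most four of at least six vertices leaves two, and each has a
      nontail into the triangle besides \<open>{r, p}\<close>.\<close>
    have "card (S - {p, q, r, f r}) + card {{r, p}} \<le> card nontails"
    proof (rule card_ge_pairs[where Q = "{p, q, r}"])
      fix w assume w: "w \<in> S - {p, q, r, f r}"
      then have "{w, p} \<notin> tails \<or> {w, q} \<notin> tails \<or> {w, r} \<notin> tails"
        using tails_adjacent[of w p] tails_adjacent[of w q] tails_adjacent[of w r] fp fq fr pqr
        by auto
      then have "\<exists>x\<in>{p, q, r}. {w, x} \<in> nontails" using nt w pqr by blast
      then show "\<exists>x\<in>{p, q, r}. {w, x} \<in> nontails \<and> {w, x} \<notin> {{r, p}}"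
        using w by (auto simp: doubleton_eq_iff)
    qed (use finite_nontails rp in auto)
    moreover have "card S - card {p, q, r, f r} \<le> card (S - {p, q, r, f r})"
      by (rule diff_card_le_card_Diff) simp
    moreover have "card {p, q, r, f r} \<le> 4" by (simp add: card_insert_if)
    ultimately show ?thesis using cardS by simp
  qed
  have sub: "{p, q, r} \<subseteq> S" using pqr S by auto
  have "arc p q \<or> arc q p" "arc q r \<or> arc r q" "arc p r \<or> arc r p"
    using arc_cases[of p q] arc_cases[of q r] arc_cases[of p r] pqr(1) triangle by auto
  moreover have "3 \<le> card nontails" if cyc: "arc p q" "arc q r" "arc r p"
      and pqr: "distinct [u, p, q, r]" "{p, q, r} \<subseteq> S" for p q r
  proof (cases "{p, q} \<in> tails \<or> {q, r} \<in> tails \<or> {r, p} \<in> tails")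
    case True
    \<comment> \<open>Rotation preserves the cyclic arcs, so \<open>cyclic\<close> applies to
      whichever side is a tail.\<close>
    then show ?thesis
      using cyclic[OF cyc] cyclic[OF cyc(2,3,1)] cyclic[OF cyc(3,1,2)] pqr by auto
  next
    case False
    then have "{p, q} \<in> nontails" "{q, r} \<in> nontails" "{r, p} \<in> nontails" using nt pqr by auto
    then show ?thesis using three[of "{p, q}" "{q, r}" "{r, p}"] pqr(1) by (auto simp: doubleton_eq_iff)
  qed
  ultimately show ?thesis
    using fork[of p q r] fork[of p r q] fork[of q p r] fork[of q r p] fork[of r p q] fork[of r q p]
      pqr(1) sub by (smt (verit) distinct_length_2_or_more insert_commute)
qed

section \<open>Edge counts for an odd number of vertices\<close>

text \<open>An unmated edge whose tail leaves \<open>S\<close> is an out-edge of a vertex in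
  \<open>V - S\<close>; \<open>card_tails\<close> counts the others.\<close>

lemma card_unmated_edges: "card unmated_edges \<le> card tails + (\<Sum>u\<in>V - S. card (out_edges u))"
proof -
  have "e \<in> (\<Union>u\<in>V - S. out_edges u)" if e: "e \<in> unmated_edges" "\<not> fst e \<subseteq> S" for e
    using e edge[of "fst e" "snd e"] by (auto simp: unmated_edges_def out_edges_def)
  then have "unmated_edges \<subseteq> {e \<in> unmated_edges. fst e \<subseteq> S} \<union> (\<Union>u\<in>V - S. out_edges u)"
    by blast
  then have "card unmated_edges \<le> card ({e \<in> unmated_edges. fst e \<subseteq> S} \<union> (\<Union>u\<in>V - S. out_edges u))"
    using finite_edges finite_verts by (intro card_mono) (auto simp: unmated_edges_def)
  also have "\<dots> \<le> card tails + card (\<Union>u\<in>V - S. out_edges u)"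
    unfolding card_tails[symmetric] by (rule card_Un_le)
  also have "card (\<Union>u\<in>V - S. out_edges u) \<le> (\<Sum>u\<in>V - S. card (out_edges u))"
    using finite_verts by (intro card_UN_le) simp
  finally show ?thesis by simp
qed

lemma card_edges_split: "card E = card (E - unmated_edges) + card unmated_edges"
  using finite_edges by (metis (no_types, lifting) card_Diff_subset card_mono finite_subset
      le_add_diff_inverse2 mem_Collect_eq subsetI unmated_edges_def)

lemma two_card_tails_le: "2 * card tails \<le> card (S - mated) * (card (S - mated) - 1)"
proof -
  have "2 * (card (S - mated) choose 2) = card (S - mated) * (card (S - mated) - 1)"
    unfolding choose_two by (intro dvd_mult_div_cancel) (cases "card (S - mated)", auto)
  then show ?thesis using card_tails_plus_nontails by linarith
qed

lemma card_S_mated: "card S = card mated + card (S - mated)"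
  using mated_subset finite_S by (metis card_Diff_subset card_mono finite_subset le_add_diff_inverse)

lemma card_mated_cases: "mated = {} \<or> (\<exists>m. card mated = 2 * m + 2)"
proof -
  have "finite mated" using mated_subset finite_S finite_subset by blast
  then have "mated = {} \<or> card mated \<noteq> 0" by simp
  moreover have "\<exists>m. card mated = 2 * m" by (metis card_mated_pairs)
  ultimately show ?thesis by (metis One_nat_def add.commute mult_0_right mult_Suc_right not0_implies_Suc)
qed

text \<open>Without mates, the \<open>2 * k\<close> nontails are subtracted from all pairs of
  vertices. With mates, the bounds for mated edges and for tails are added, using that the number
  \<open>w\<close> of unmated vertices is at most \<open>2 * k - 1\<close>.\<close>

lemma card_edges_no_triangle:
  assumes "S = V" "card V = 2 * k + 1" "k \<ge> 3"
  shows "card E \<le> k * (2 * k - 1)"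
proof (cases "mated = {}")
  case True
  then have "unmated_edges = E" by (auto simp: unmated_edges_def)
  then have "card E + 2 * k \<le> card V choose 2"
    using card_unmated_edges card_tails_plus_nontails nontails_without_mates[OF assms(1) True] assms True
    by simp
  moreover have "card V choose 2 = (2 * k + 1) * k" using assms(2) by (simp add: choose_two)
  ultimately show ?thesis by (simp add: algebra_simps)
next
  case False
  then obtain m where m: "card mated = 2 * m + 2" using card_mated_cases by blast
  define w where "w = card (S - mated)"
  have n: "2 * k + 1 = 2 * m + 2 + w" using card_S_mated m assms(1,2) w_def by simp
  \<comment> \<open>\<open>w\<close> is odd, which makes \<open>w - 1\<close> a genuine subtraction
    and supplies the saving of one vertex.\<close>
  then have "w \<ge> 1" by presburger
  have "2 * card E \<le> (2 * m + 2) * (2 * k - 1) + w * (w - 1)"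
    using card_edges_split card_mated_edges card_unmated_edges two_card_tails_le assms(1,2) m
    by (simp add: w_def)
  also have "w * (w - 1) \<le> (2 * k - 1) * (w - 1)" using n by (intro mult_right_mono) simp_all
  also have "(2 * m + 2) * (2 * k - 1) + (2 * k - 1) * (w - 1) = (2 * k - 1) * (2 * m + 2 + (w - 1))"
    by (simp only: distrib_left mult.commute)
  also have "2 * m + 2 + (w - 1) = 2 * k" using n \<open>w \<ge> 1\<close> by simp
  finally show ?thesis by (simp add: mult.commute)
qed

text \<open>Without mates, the three edges at \<open>u\<close> and the three nontails cancel,
  leaving \<open>2 * k choose 2\<close>. With mates, each of the \<open>2 * k\<close> vertices of
  \<open>S\<close> accounts for \<open>2 * k - 1\<close> in twice the edge count.\<close>

lemma card_edges_one_triangle: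
  assumes S: "S = V - {u}" "u \<in> V" and u: "\<nexists>c. centre_of u c"
    and k: "card V = 2 * k + 1" "k \<ge> 3"
  shows "card E \<le> k * (2 * k - 1)"
proof -
  have VS: "V - S = {u}" using S by auto
  have three: "card (out_edges u) \<le> 3"
    using card_out_edges_triangle[OF u S(2)] k by simp
  have cardS: "card S = 2 * k" using S k finite_verts by simp
  show ?thesis
  proof (cases "mated = {}")
    case True
    obtain p q r where pqr: "distinct [u, p, q, r]" "{p, q, r} \<subseteq> V"
        "support ` out_edges u = {{u, p, q}, {u, q, r}, {u, p, r}}"
      using k by (rule_tac no_centre_triangle[OF u S(2)]) auto
    have "3 \<le> card nontails"
      using k by (intro nontails_with_triangle[OF S(1) True S(2) _ pqr]) simp
    moreover have "unmated_edges = E" using True by (auto simp: unmated_edges_def)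
    ultimately have "card E \<le> 2 * k choose 2"
      using card_unmated_edges card_tails_plus_nontails VS three True cardS by simp
    then show ?thesis by (simp add: choose_two)
  next
    case False
    then obtain m where m: "card mated = 2 * m + 2" using card_mated_cases by blast
    define w where "w = card (S - mated)"
    have n: "2 * k = 2 * m + 2 + w" using card_S_mated m cardS w_def by simp
    have mated_part: "2 * card (E - unmated_edges) \<le> (2 * m + 2) * (2 * k - 1)"
      using card_mated_edges m k by simp
    have "2 * card unmated_edges \<le> w * (2 * k - 1)"
    \<comment> \<open>For \<open>w = 0\<close> there is no room for the edges at \<open>u\<close>,
      but a tail avoiding \<open>mated\<close> would have to fit inside \<open>{u}\<close>.\<close>
    proof (cases "w = 0")
      case True
      then have "S \<subseteq> mated" using finite_S by (simp add: w_def)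
      have "e \<notin> unmated_edges" for e
      proof
        assume e: "e \<in> unmated_edges"
        then have "fst e \<subseteq> V" "card (fst e) = 2" "fst e \<inter> mated = {}"
          using edge[of "fst e" "snd e"] by (auto simp: unmated_edges_def)
        then have "fst e \<subseteq> {u}" using VS \<open>S \<subseteq> mated\<close> by blast
        then show False using \<open>card (fst e) = 2\<close> card_mono[of "{u}" "fst e"] by simp
      qed
      then have "unmated_edges = {}" by blast
      then show ?thesis by simp
    next
      case False
      then obtain v where v: "w = 2 * v + 2"
        using n by (metis add_diff_cancel_left' add_2_eq_Suc' diff_mult_distrib2 mult_0_right mult_Suc_right not0_implies_Suc add.commute)
      have "2 * card unmated_edges \<le> w * (w - 1) + 6"
        using card_unmated_edges two_card_tails_le VS three by (simp add: w_def)
      also have "\<dots> \<le> w * (2 * k - 1)"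
      proof -
        have kv: "k = m + v + 2" using n v by simp
        \<comment> \<open>The 6 is twice the number of triangle edges. Both factors are positive and
          even, so the product is too small only if both are 2, that is for
          \<open>k = 2\<close>.\<close>
        have "6 \<le> w * (2 * m + 2)"
        proof (cases "v = 0")
          case True
          then show ?thesis using kv k(2) v by simp
        next
          case False
          then show ?thesis using v by (simp add: algebra_simps)
        qed
        moreover have "w * (2 * k - 1) = w * (w - 1) + w * (2 * m + 2)"
          unfolding kv v by (simp add: algebra_simps)
        ultimately show ?thesis by simp
      qed
      finally show ?thesis .
    qed
    then have "2 * card E \<le> (2 * m + 2 + w) * (2 * k - 1)"
      unfolding card_edges_split distrib_left distrib_right[of "2 * m + 2"]
      using mated_part by (rule_tac add_mono)
    then show ?thesis unfolding n[symmetric] by simp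
  qed
qed

end

section \<open>The extremal number\<close>

context h1_free
begin

lemma card_edges_le:
  assumes "card V \<ge> 6"
  shows "card E \<le> (card V div 2) * (card V - 2)"
proof -
  define T where "T = {x \<in> V. \<nexists>c. centre_of x c}"
  define f where "f x = (SOME c. centre_of x c)" for x
  have "finite T" "T \<subseteq> V" using finite_verts by (auto simp: T_def)
  have centre: "centre_of x (f x)" if "x \<in> V - T" for x
    using that unfolding T_def f_def by (metis (mono_tags, lifting) DiffE mem_Collect_eq someI_ex)
  have "2 * card E = (\<Sum>x\<in>V - T. card (out_edges x)) + (\<Sum>x\<in>T. card (out_edges x))"
    using sum_card_out_edges sum.subset_diff[OF \<open>T \<subseteq> V\<close> finite_verts, of "\<lambda>x. card (out_edges x)"]
    by simp
  also have "\<dots> \<le> (\<Sum>x\<in>V - T. card V - 2) + (\<Sum>x\<in>T. 3)"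
  proof (intro add_mono sum_mono)
    fix x assume "x \<in> V - T"
    then show "card (out_edges x) \<le> card V - 2" using card_out_edges_star centre by blast
  next
    fix x assume "x \<in> T"
    then show "card (out_edges x) \<le> 3"
      using card_out_edges_triangle[of x] \<open>card V \<ge> 6\<close> by (simp add: T_def)
  qed
  also have "\<dots> = (card V - card T) * (card V - 2) + 3 * card T"
    using \<open>finite T\<close> \<open>T \<subseteq> V\<close> by (simp add: card_Diff_subset)
  finally have sum: "2 * card E \<le> (card V - card T) * (card V - 2) + 3 * card T" .
  have TV: "card T \<le> card V" using \<open>T \<subseteq> V\<close> finite_verts by (rule_tac card_mono)
  \<comment> \<open>Since \<open>3 \<le> card V - 2\<close>, counting a triangle vertex as a star
    only weakens the bound, so a lower estimate of \<open>card T\<close> suffices.\<close>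
  have few: "2 * card E \<le> (card V - j) * (card V - 2) + 3 * j" if "j \<le> card T" for j
  proof -
    obtain i where i: "card T = j + i" using \<open>j \<le> card T\<close> le_Suc_ex by blast
    then have "(card V - j) * (card V - 2) = (card V - card T) * (card V - 2) + i * (card V - 2)"
      using TV by (simp flip: add_mult_distrib)
    moreover have "i * 3 \<le> i * (card V - 2)" using \<open>card V \<ge> 6\<close> by (intro mult_left_mono) auto
    moreover have "3 * card T = 3 * j + i * 3" using i by simp
    ultimately show ?thesis using sum by linarith
  qed
  show ?thesis
  proof (cases "even (card V)")
    case True
    then obtain k where k: "card V = 2 * k" by blast
    then show ?thesis using few[of 0] by simp
  next
    case False
    then obtain k where k: "card V = 2 * k + 1" by (metis oddE)
    have "k \<ge> 3" using k \<open>card V \<ge> 6\<close> by simp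
    consider "T = {}" | u where "T = {u}" | "card T \<ge> 2"
      using \<open>finite T\<close> by (metis One_nat_def Suc_1 Suc_leI card_1_singletonE card_gt_0_iff le_neq_implies_less)
    then have "card E \<le> k * (2 * k - 1)"
    proof cases
      case 1
      then interpret centred_h1_free V E V f using centre by unfold_locales auto
      show ?thesis using card_edges_no_triangle k \<open>k \<ge> 3\<close> by simp
    next
      case (2 u)
      then interpret centred_h1_free V E "V - {u}" f using centre by unfold_locales auto
      have "u \<in> T" using 2 by simp
      then show ?thesis using card_edges_one_triangle[of u] k \<open>k \<ge> 3\<close> by (simp add: T_def)
    next
      case 3
      obtain j where j: "k = j + 3" using \<open>k \<ge> 3\<close> le_Suc_ex by (metis add.commute)
      have "card V - 2 = 2 * j + 5" using k j by simp
      then have "2 * card E \<le> (2 * j + 5) * (2 * j + 5) + 6" using few[OF 3] by simp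
      \<comment> \<open>For \<open>j = 0\<close> this compares 31 with 30 after doubling;
        integrality of \<open>card E\<close> closes the gap.\<close>
      then have "card E \<le> (j + 3) * (2 * j + 5)" by (simp add: algebra_simps)
      moreover have "2 * k - 1 = 2 * j + 5" using j by simp
      ultimately show ?thesis using j by metis
    qed
    moreover have "card V div 2 = k" "card V - 2 = 2 * k - 1" using k by simp_all
    ultimately show ?thesis by simp
  qed
qed

end

section \<open>Transfer from graphs to the locale\<close>

lemma h1_free_graph:
  assumes H: "two_one_graph H" "oriented H" and free: "free_of H1 H"
  shows "h1_free (verts H) (edges H)"
proof
  show fin: "finite (verts H)" using H(1) by (simp add: two_one_graph_def)
  have edge: "T \<subseteq> verts H \<and> card T = 2 \<and> h \<in> verts H \<and> h \<notin> T" if "(T, h) \<in> edges H" for T h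
    using that H(1) unfolding two_one_graph_def by blast
  then show "\<And>T h. (T, h) \<in> edges H \<Longrightarrow> T \<subseteq> verts H \<and> card T = 2 \<and> h \<in> verts H \<and> h \<notin> T" .
  have "edges H \<subseteq> Pow (verts H) \<times> verts H" using edge by auto
  then have finE: "finite (edges H)" using fin by (meson finite_Pow_iff finite_SigmaI finite_subset)
  show "inj_on support (edges H)"
  proof (rule inj_onI)
    fix e e' assume e: "e \<in> edges H" "e' \<in> edges H" "support e = support e'"
    have T: "fst e \<subseteq> verts H" "card (fst e) = 2" "snd e \<in> verts H" "snd e \<notin> fst e"
      using edge[of "fst e" "snd e"] e(1) by auto
    moreover have "finite (fst e)" using T(2) by (simp add: card_ge_0_finite)
    ultimately have "support e \<subseteq> verts H" "card (support e) = 3" by (auto simp: support_def)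
    then have "card {d \<in> edges H. support d = support e} \<le> Suc 0"
      using H(2) by (simp add: oriented_def)
    then have "\<forall>d \<in> {d \<in> edges H. support d = support e}. \<forall>d' \<in> {d \<in> edges H. support d = support e}. d = d'"
      using finE by (subst card_le_Suc0_iff_eq[symmetric]) simp_all
    then show "e = e'" using e by blast
  qed
  fix e e' x assume e: "e \<in> edges H" "e' \<in> edges H" "x \<in> fst e" "x \<in> fst e'"
  have ex: "\<exists>a b. d = ({a, x}, b) \<and> distinct [a, x, b] \<and> {a, x, b} \<subseteq> verts H"
    if d: "d \<in> edges H" "x \<in> fst d" for d
  proof -
    have T: "fst d \<subseteq> verts H" "card (fst d) = 2" "snd d \<in> verts H" "snd d \<notin> fst d"
      using edge[of "fst d" "snd d"] d by auto
    obtain y z where "fst d = {y, z}" "y \<noteq> z" using T(2) by (auto simp: card_2_iff)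
    then obtain a where a: "fst d = {a, x}" "a \<noteq> x"
      using d(2) by (metis insertE insert_commute singletonD)
    then have "d = ({a, x}, snd d)" by (metis prod.collapse)
    moreover have "distinct [a, x, snd d]" "{a, x, snd d} \<subseteq> verts H" using T(1,3,4) a by auto
    ultimately show ?thesis by blast
  qed
  obtain a b where ab: "e = ({a, x}, b)" "distinct [a, x, b]" "{a, x, b} \<subseteq> verts H"
    using ex[OF e(1,3)] by blast
  obtain c d where cd: "e' = ({c, x}, d)" "distinct [c, x, d]" "{c, x, d} \<subseteq> verts H"
    using ex[OF e(2,4)] by blast
  show "\<exists>c. c \<noteq> x \<and> c \<in> support e \<and> c \<in> support e'"
  proof (rule ccontr)
    assume "\<nexists>c. c \<noteq> x \<and> c \<in> support e \<and> c \<in> support e'"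
    moreover have "support e = {a, x, b}" "support e' = {c, x, d}"
      using ab(1) cd(1) by (auto simp: support_def)
    ultimately have "a \<notin> {c, d}" "b \<notin> {c, d}" using ab(2) by auto
    then have d: "distinct [a, b, c, d, x]" using ab(2) cd(2) by auto
    define \<phi> where "\<phi> v = (case v of Va \<Rightarrow> a | Vb \<Rightarrow> b | Vc \<Rightarrow> c | Vd \<Rightarrow> d | Vx \<Rightarrow> x)" for v
    have \<phi>: "\<phi> Va = a" "\<phi> Vb = b" "\<phi> Vc = c" "\<phi> Vd = d" "\<phi> Vx = x"
      by (simp_all add: \<phi>_def)
    have "({a, x}, b) \<in> edges H" "({c, x}, d) \<in> edges H" using e(1,2) ab(1) cd(1) by simp_all
    moreover have "inj_on \<phi> {Va, Vb, Vc, Vd, Vx}" using d by (auto simp: inj_on_def \<phi>)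
    ultimately have "embedding \<phi> H1 H"
      using ab(3) cd(3) by (simp add: embedding_def H1_def \<phi>)
    then show False using free by (auto simp: free_of_def)
  qed
qed

section \<open>The extremal construction\<close>

text \<open>For odd \<open>n\<close> the vertex \<open>n - 1\<close> lies in no pair and can occur
  only as a head.\<close>

definition pair_graph :: "nat \<Rightarrow> nat dhgraph" where
  "pair_graph n = \<lparr>verts = {..<n},
     edges = (\<lambda>(i, v). ({2 * i, 2 * i + 1}, v)) ` (SIGMA i:{..<n div 2}. {..<n} - {2 * i, 2 * i + 1})\<rparr>"

lemma pair_graph_edge_iff:
  "(T, h) \<in> edges (pair_graph n) \<longleftrightarrow>
     (\<exists>i < n div 2. T = {2 * i, 2 * i + 1} \<and> h < n \<and> h \<notin> {2 * i, 2 * i + 1})"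
  by (auto simp: pair_graph_def image_iff Bex_def)

text \<open>Seeing the pairs as fibres of \<open>div 2\<close> makes their disjointness a matter of
  arithmetic.\<close>

lemma mem_pair_iff: "x \<in> {2 * i, 2 * i + 1} \<longleftrightarrow> x div 2 = i" for x i :: nat
  by auto

lemma card_pair_graph: "card (edges (pair_graph n)) = (n div 2) * (n - 2)"
proof -
  have "inj_on (\<lambda>(i, v). ({2 * i, 2 * i + 1}, v)) (SIGMA i:{..<n div 2}. {..<n} - {2 * i, 2 * i + 1})"
    by (auto simp: inj_on_def doubleton_eq_iff)
  then have "card (edges (pair_graph n)) = (\<Sum>i<n div 2. card ({..<n} - {2 * i, 2 * i + 1}))"
    by (simp add: pair_graph_def card_image)
  also have "\<dots> = (\<Sum>i<n div 2. n - 2)"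
    by (intro sum.cong) (auto simp: card_Diff_subset)
  finally show ?thesis by simp
qed

lemma two_one_graph_pair_graph: "two_one_graph (pair_graph n)"
proof -
  have "T \<subseteq> {..<n} \<and> card T = 2 \<and> h < n \<and> h \<notin> T" if "(T, h) \<in> edges (pair_graph n)" for T h
    using that unfolding pair_graph_edge_iff by auto
  moreover have "verts (pair_graph n) = {..<n}" by (simp add: pair_graph_def)
  ultimately show ?thesis unfolding two_one_graph_def by auto
qed

lemma oriented_pair_graph: "oriented (pair_graph n)"
  unfolding oriented_def
proof (intro allI impI)
  fix S assume "S \<subseteq> verts (pair_graph n) \<and> card S = 3"
  let ?D = "{e \<in> edges (pair_graph n). support e = S}"
  have "e = e'" if e: "e \<in> ?D" and e': "e' \<in> ?D" for e e'
  proof -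
    obtain i h where i: "e = ({2 * i, 2 * i + 1}, h)" "h \<notin> {2 * i, 2 * i + 1}"
      using e pair_graph_edge_iff[of "fst e" "snd e" n] by (auto simp: prod_eq_iff)
    obtain j g where j: "e' = ({2 * j, 2 * j + 1}, g)" "g \<notin> {2 * j, 2 * j + 1}"
      using e' pair_graph_edge_iff[of "fst e'" "snd e'" n] by (auto simp: prod_eq_iff)
    have "insert h {2 * i, 2 * i + 1} = insert g {2 * j, 2 * j + 1}"
      using e e' i j by (simp add: support_def)
    then have eq: "x = h \<or> x div 2 = i \<longleftrightarrow> x = g \<or> x div 2 = j" for x
      unfolding set_eq_iff insert_iff[of _ h] insert_iff[of _ g] mem_pair_iff by blast
    have "i = j"
    proof (rule ccontr)
      assume "i \<noteq> j"
      moreover have "2 * i div 2 = i" "(2 * i + 1) div 2 = i" by simp_all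
      \<comment> \<open>Neither element of pair \<open>i\<close> lies in pair \<open>j\<close>, so
        both would have to be the head \<open>g\<close>.\<close>
      ultimately have "2 * i = g" "2 * i + 1 = g" using eq by metis+
      then show False by simp
    qed
    moreover have "h div 2 \<noteq> i" "g div 2 \<noteq> j" using i j unfolding mem_pair_iff by auto
    ultimately show ?thesis using eq[of h] i j by auto
  qed
  then show "card ?D \<le> 1" by (metis (no_types, lifting) One_nat_def card.infinite card_le_Suc0_iff_eq zero_le_one)
qed

text \<open>Distinct pairs are disjoint, so two tails through the image of \<open>Vx\<close>
  coincide, and with them the images of \<open>Va\<close> and \<open>Vc\<close>.\<close>

lemma free_of_pair_graph: "free_of H1 (pair_graph n)"
proof -
  have False if emb: "embedding \<phi> H1 (pair_graph n)" for \<phi>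
  proof -
    have inj: "distinct [\<phi> Va, \<phi> Vc, \<phi> Vx]"
      and edges: "({\<phi> Va, \<phi> Vx}, \<phi> Vb) \<in> edges (pair_graph n)"
        "({\<phi> Vc, \<phi> Vx}, \<phi> Vd) \<in> edges (pair_graph n)"
      using emb by (auto simp: embedding_def H1_def inj_on_def)
    from edges obtain i j where "{\<phi> Va, \<phi> Vx} = {2 * i, 2 * i + 1}" "{\<phi> Vc, \<phi> Vx} = {2 * j, 2 * j + 1}"
      unfolding pair_graph_edge_iff by blast
    then have "\<phi> Va div 2 = i" "\<phi> Vx div 2 = i" "\<phi> Vc div 2 = j" "\<phi> Vx div 2 = j"
      unfolding mem_pair_iff[symmetric] by blast+
    then show False using inj by simp presburger
  qed
  then show ?thesis by (auto simp: free_of_def)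
qed

theorem theorem4p1:
  fixes n :: nat
  assumes "n \<ge> 6"
  shows "ex_o n H1 = (n div 2) * (n - 2)"
proof -
  let ?X = "{card (edges H) | H :: nat dhgraph.
     two_one_graph H \<and> oriented H \<and> card (verts H) = n \<and> free_of H1 H}"
  have le: "m \<le> (n div 2) * (n - 2)" if "m \<in> ?X" for m
    using that h1_free.card_edges_le[OF h1_free_graph] assms by blast
  have "card (verts (pair_graph n)) = n" by (simp add: pair_graph_def)
  then have "(n div 2) * (n - 2) \<in> ?X"
    using card_pair_graph[of n] two_one_graph_pair_graph oriented_pair_graph free_of_pair_graph
    by (metis (mono_tags, lifting) mem_Collect_eq)
  \<comment> \<open>The upper bound also yields the finiteness that \<open>Max\<close>
    requires.\<close>
  moreover have "finite ?X" using le by (intro finite_subset[of ?X "{..(n div 2) * (n - 2)}"]) auto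
  ultimately show ?thesis unfolding ex_o_def using le by (intro Max_eqI)
qed

end
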